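(* Let $0<p,q\le1$, let $h:[0,\infty)\times[0,\infty)\to\mathbb{R}$ be piecewise continuous and of exponential order $(a,b)$, and let $G_{p.q}(r,s)=\mathcal{G}_x^p\mathcal{G}_t^q\left[h\left(\frac{x^p}{p},\frac{t^q}{q}\right)\right](r,s)$. Then for all $r,s\in\mathbb{C}\setminus\{0\}$ with $\operatorname{Re}(r)>a$, $\operatorname{Re}(s)>b$: (i) $\displaystyle \mathcal{G}_x^p\mathcal{G}_t^q\left[\frac{x^p}{p}h\left(\frac{x^p}{p},\frac{t^q}{q}\right)\right]=-r\frac{\partial}{\partial r}\left(\frac1r\,G_{p.q}(r,s)\right).$ (ii) $\displaystyle \mathcal{G}_x^p\mathcal{G}_t^q\left[\frac{t^q}{q}h\left(\frac{x^p}{p},\frac{t^q}{q}\right)\right]=-s\frac{\partial}{\partial s}\left(\frac1s\,G_{p.q}(r,s)\right).$ (iii) $\displaystyle \mathcal{G}_x^p\mathcal{G}_t^q\left[\left(\frac{x^p}{p}\right)^2h\left(\frac{x^p}{p},\frac{t^q}{q}\right)\right]=\frac{\partial^2G_{p.q}(r,s)}{\partial r^2}-\frac2r\frac{\partial G_{p.q}(r,s)}{\partial r}+\frac{2}{r^2}G_{p.q}(r,s).$ (iv) $\displaystyle \mathcal{G}_x^p\mathcal{G}_t^q\left[\left(\frac{t^q}{q}\right)^2h\left(\frac{x^p}{p},\frac{t^q}{q}\right)\right]=\frac{\partial^2G_{p.q}(r,s)}{\partial s^2}-\frac2s\frac{\partial G_{p.q}(r,s)}{\partial s}+\frac{2}{s^2}G_{p.q}(r,s).$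 (v) $\displaystyle \mathcal{G}_x^p\mathcal{G}_t^q\left[\frac{x^p}{p}\frac{t^q}{q}h\left(\frac{x^p}{p},\frac{t^q}{q}\right)\right]=\frac{\partial^2G_{p.q}(r,s)}{\partial r\,\partial s}-\frac1s\frac{\partial G_{p.q}(r,s)}{\partial r}-\frac1r\frac{\partial G_{p.q}(r,s)}{\partial s}+\frac{1}{rs}G_{p.q}(r,s).$ All transforms are evaluated at $(r,s)$.
   Context: Conformable double ARA transform (CDARAT): for $0<p,q\le1$ and a function $h(u,v)$ on $[0,\infty)\times[0,\infty)$, $$\mathcal{G}_x^p\mathcal{G}_t^q\left[h\left(\tfrac{x^p}{p},\tfrac{t^q}{q}\right)\right](r,s)=rs\int_0^\infty\int_0^\infty e^{-r\frac{x^p}{p}-s\frac{t^q}{q}}\,h\left(\tfrac{x^p}{p},\tfrac{t^q}{q}\right)x^{p-1}t^{q-1}\,dx\,dt,\qquad r,s\in\mathbb{C}.$$ A function $h$ is of exponential order $(a,b)$, $a,b\in\mathbb{R}$, if $\sup_{u,v>0}\dfrac{|h(u,v)|}{e^{au+bv}}<\infty$. *)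

theory Defs
  imports "HOL-Analysis.Analysis"
begin

(* Every bounded rectangle splits into finitely many open pieces, with boundaries of
   measure zero; on each piece h is continuous, with finite limits from inside the piece at all
   boundary points.  The pieces may be rectangles, but may also have curved boundaries. The values
   of h on the boundaries are unrestricted. *)
definition piecewise_continuous_quadrant :: "(real \<Rightarrow> real \<Rightarrow> real) \<Rightarrow> bool" where
  "piecewise_continuous_quadrant h \<longleftrightarrow>
    (\<forall>A>0. \<forall>B>0. \<exists>\<U>.
       finite \<U> \<and> disjoint \<U> \<and> (\<Union>U\<in>\<U>. closure U) = {0..A} \<times> {0..B} \<and>
       (\<forall>U\<in>\<U>. open U \<and> negligible (frontier U) \<and>
          continuous_on U (\<lambda>(u, v). h u v) \<and>
          (\<forall>z\<in>frontier U. \<exists>l. ((\<lambda>(u, v). h u v) \<longlongrightarrow> l) (at z within U))))"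

definition exponential_order :: "(real \<Rightarrow> real \<Rightarrow> real) \<Rightarrow> real \<Rightarrow> real \<Rightarrow> bool" where
  "exponential_order h a b \<longleftrightarrow>
    bdd_above ((\<lambda>(u, v). \<bar>h u v\<bar> / exp (a * u + b * v)) ` ({0<..} \<times> {0<..}))"

definition cdarat_integrand ::
  "real \<Rightarrow> real \<Rightarrow> (real \<Rightarrow> real \<Rightarrow> real) \<Rightarrow> complex \<Rightarrow> complex \<Rightarrow> real \<Rightarrow> real \<Rightarrow> complex" where
  "cdarat_integrand p q f r s x t =
    exp (- r * of_real (x powr p / p) - s * of_real (t powr q / q))
      * of_real (f x t * x powr (p - 1) * t powr (q - 1))"

(* Here f is the function of (x, t) between the brackets of the transform, i.e.
   f x t = h (x powr p / p) (t powr q / q) for the transform of h.  The integrals are taken with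
   respect to the complete measure lebesgue rather than lborel, since a piecewise continuous
   function need not be Borel measurable. *)
definition cdarat ::
  "real \<Rightarrow> real \<Rightarrow> (real \<Rightarrow> real \<Rightarrow> real) \<Rightarrow> complex \<Rightarrow> complex \<Rightarrow> complex" where
  "cdarat p q f r s =
    r * s * (LINT t:{0..}|lebesgue. (LINT x:{0..}|lebesgue. cdarat_integrand p q f r s x t))"

(* Absolute convergence of the double integral, which by Fubini's theorem makes the iterated
   integral in cdarat meaningful. *)
definition cdarat_converges ::
  "real \<Rightarrow> real \<Rightarrow> (real \<Rightarrow> real \<Rightarrow> real) \<Rightarrow> complex \<Rightarrow> complex \<Rightarrow> bool" where
  "cdarat_converges p q f r s \<longleftrightarrow>
    set_integrable lebesgue ({0..} \<times> {0..}) (\<lambda>(x, t). cdarat_integrand p q f r s x t)"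

definition partial_r :: "(complex \<Rightarrow> complex \<Rightarrow> complex) \<Rightarrow> complex \<Rightarrow> complex \<Rightarrow> complex" where
  "partial_r F r s = deriv (\<lambda>z. F z s) r"

definition partial_s :: "(complex \<Rightarrow> complex \<Rightarrow> complex) \<Rightarrow> complex \<Rightarrow> complex \<Rightarrow> complex" where
  "partial_s F r s = deriv (\<lambda>z. F r z) s"

(* deriv is total, so existence of the partial derivatives has to be asserted separately. *)
definition has_partial_r :: "(complex \<Rightarrow> complex \<Rightarrow> complex) \<Rightarrow> complex \<Rightarrow> complex \<Rightarrow> bool" where
  "has_partial_r F r s \<longleftrightarrow> (\<lambda>z. F z s) field_differentiable at r"

definition has_partial_s :: "(complex \<Rightarrow> complex \<Rightarrow> complex) \<Rightarrow> complex \<Rightarrow> complex \<Rightarrow> bool" where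
  "has_partial_s F r s \<longleftrightarrow> (\<lambda>z. F r z) field_differentiable at s"

end

theory Submission
  imports Defs
begin

text \<open>
  In the variables \<open>X = x powr p / p\<close> and \<open>Y = t powr q / q\<close> the transform is \<open>r * s\<close> times a double
  Laplace transform. Write \<open>F m n r s\<close> for the double Laplace transform of \<open>X ^ m * Y ^ n * h\<close>
  (\<open>double_laplace_moment\<close>). Differentiation under the integral sign brings down a factor \<open>- X\<close> or
  \<open>- Y\<close>, so the partial derivatives of \<open>F m n\<close> are \<open>- F (m + 1) n\<close> and \<open>- F m (n + 1)\<close>. Since
  \<open>G r s = r * s * F 0 0 r s\<close> and the transforms on the left-hand sides are \<open>r * s * F m n r s\<close>, all
  five identities are the product rule.

  The analytic content is the differentiation under the integral sign. It needs nothing but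
  integrability of the kernel on the whole region \<open>Re r > a\<close>, \<open>Re s > b\<close>: an arbitrarily small part
  of the exponential decay dominates any power of \<open>X\<close> and \<open>Y\<close> (\<open>laplace_integral_derivative\<close>,
  iterated in \<open>two_variable_laplace_moments\<close>). This includes the absolute convergence of the
  transforms of all moments.

  The rest is measure theory. The kernel is integrable because exponential order bounds it by a
  product of one-dimensional functions with explicit antiderivatives
  (\<open>conformable_kernel_integrable\<close>). It is Lebesgue measurable because \<open>h\<close> is continuous on an
  open set of full measure and the substitution is a diffeomorphism of the open quadrant
  (\<open>measurable_conformable_substitution\<close>). The iterated integral that defines the transform is an
  integral over the plane by Fubini (\<open>Fubini_lebesgue_complex\<close>).
\<close>

section \<open>Differentiating Laplace integrals over an arbitrary measure space\<close>

text \<open>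
  A half-plane of integrability pays for everything here: moving \<open>z\<close> to the left by a small \<open>2 d\<close>
  stays inside the half-plane, and the gained factor \<open>exp (2 d X)\<close> absorbs both the factor \<open>X\<close>
  and the variation of \<open>exp (- y X)\<close> over the ball of radius \<open>d\<close> around \<open>z\<close>. One fixed
  integrable function thus dominates the new integrand and all difference quotients. The exponent
  function \<open>X\<close> and the measure are arbitrary, so the lemma applies again to the weight \<open>X * g\<close>
  and to either variable of a double transform.
\<close>

lemma laplace_integral_derivative:
  fixes X :: "'w \<Rightarrow> real" and g :: "'w \<Rightarrow> complex" and z :: complex
  assumes X [measurable]: "X \<in> borel_measurable M" and X0: "\<And>w. 0 \<le> X w"
    and int: "\<And>z :: complex. a < Re z \<Longrightarrow> integrable M (\<lambda>w. exp (- z * X w) * g w)"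
    and z: "a < Re z"
  shows integrable_laplace_moment: "integrable M (\<lambda>w. X w * (exp (- z * X w) * g w))"
    and has_field_derivative_laplace:
      "((\<lambda>z :: complex. \<integral>w. exp (- z * X w) * g w \<partial>M) has_field_derivative
         - (\<integral>w. X w * (exp (- z * X w) * g w) \<partial>M)) (at z)"
proof -
  define d where "d = (Re z - a) / 3"
  have d: "d > 0" "a < Re (z - 2 * d)" using z by (auto simp: d_def field_simps)
  define W where "W w = norm (exp (- (z - 2 * d) * X w) * g w) / d" for w
  have W: "integrable M W"
    using int[OF d(2)] unfolding W_def by (intro integrable_divide integrable_norm)
  have meas [measurable]: "(\<lambda>w. exp (- y * X w) * g w) \<in> borel_measurable M" if "a < Re y" for y :: complex
    using int[OF that] by (rule borel_measurable_integrable)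
  \<comment> \<open>One \<open>d\<close> of the shift is spent on \<open>y\<close> lying to the left of \<open>z\<close>, the other on \<open>X \<le> exp (d X) / d\<close>.\<close>
  have bound: "norm (X w * exp (- y * X w)) \<le> norm (exp (- (z - 2 * d) * X w)) / d"
    if "y \<in> ball z d" for y :: complex and w
  proof -
    have "Re (z - y) \<le> d"
      using that abs_Re_le_cmod[of "z - y"] by (simp add: dist_norm)
    then have "- Re y * X w \<le> (d - Re z) * X w"
      using X0[of w] by (intro mult_right_mono) auto
    then have 1: "exp (- Re y * X w) \<le> exp ((d - Re z) * X w)" by simp
    have "d * X w \<le> exp (d * X w)"
      using exp_ge_add_one_self[of "d * X w"] by linarith
    then have 2: "X w \<le> exp (d * X w) / d" using d by (simp add: field_simps)
    have "norm (X w * exp (- y * X w)) = X w * exp (- Re y * X w)"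
      using X0[of w] by (simp add: norm_mult)
    also have "\<dots> \<le> exp (d * X w) / d * exp ((d - Re z) * X w)"
      using 1 2 X0[of w] d by (intro mult_mono) auto
    also have "\<dots> = norm (exp (- (z - 2 * d) * X w)) / d"
      by (simp add: exp_add[symmetric] algebra_simps)
    finally show ?thesis .
  qed
  show "integrable M (\<lambda>w. X w * (exp (- z * X w) * g w))"
  proof (rule Bochner_Integration.integrable_bound[OF W])
    show "(\<lambda>w. X w * (exp (- z * X w) * g w)) \<in> borel_measurable M"
      using meas[OF z] by measurable
    have "norm (X w * exp (- z * X w)) * norm (g w) \<le> W w" for w
      using mult_right_mono[OF bound[of z w], of "norm (g w)"] d
      by (simp add: W_def norm_mult)
    then show "AE w in M. norm (complex_of_real (X w) * (exp (- z * X w) * g w)) \<le> norm (W w)"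
      by (intro AE_I2) (smt (verit) mult.assoc norm_mult real_norm_def)
  qed
  let ?F = "\<lambda>z :: complex. \<integral>w. exp (- z * X w) * g w \<partial>M"
  have dexp: "((\<lambda>z :: complex. exp (- z * X w)) has_field_derivative - (X w * exp (- y * X w))) (at y within S)"
    for w and y :: complex and S
    by (auto intro!: derivative_eq_intros)
  \<comment> \<open>Dominated convergence is a statement about sequences with a bound for every index, so the
     limit is taken along sequences that stay in the ball.\<close>
  have "((\<lambda>y. (?F y - ?F z) / (y - z)) \<longlongrightarrow> - (\<integral>w. X w * (exp (- z * X w) * g w) \<partial>M))
          (at z within ball z d)"
    unfolding tendsto_at_iff_sequentially
  proof (intro allI impI)
    fix S :: "nat \<Rightarrow> complex"
    assume S: "\<forall>i. S i \<in> ball z d - {z}" and lim: "S \<longlonglongrightarrow> z"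
    have ReS: "a < Re (S i)" for i
      using S abs_Re_le_cmod[of "z - S i"] d by (auto simp: dist_norm d_def)
        (smt (verit, best) field_sum_of_halves)
    let ?s = "\<lambda>i w. (exp (- S i * X w) * g w - exp (- z * X w) * g w) / (S i - z)"
    have "(\<lambda>i. \<integral>w. ?s i w \<partial>M) \<longlonglongrightarrow> (\<integral>w. - (X w * (exp (- z * X w) * g w)) \<partial>M)"
    proof (rule integral_dominated_convergence[OF _ _ W])
      show "?s i \<in> borel_measurable M" for i
        using meas[OF ReS] meas[OF z] by measurable
      show "(\<lambda>w. - (X w * (exp (- z * X w) * g w))) \<in> borel_measurable M"
        using meas[OF z] by measurable
      show "AE w in M. (\<lambda>i. ?s i w) \<longlonglongrightarrow> - (X w * (exp (- z * X w) * g w))"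
      proof (rule AE_I2)
        fix w
        have "((\<lambda>y :: complex. (exp (- y * X w) - exp (- z * X w)) / (y - z)) \<longlongrightarrow> - (X w * exp (- z * X w)))
                (at z within ball z d)"
          using dexp unfolding has_field_derivative_iff .
        then have "((\<lambda>y :: complex. (exp (- y * X w) - exp (- z * X w)) / (y - z)) \<circ> S)
                     \<longlonglongrightarrow> - (X w * exp (- z * X w))"
          using S lim unfolding tendsto_at_iff_sequentially by blast
        from tendsto_mult_right[OF this, of "g w"]
        show "(\<lambda>i. ?s i w) \<longlonglongrightarrow> - (X w * (exp (- z * X w) * g w))"
          by (simp add: o_def algebra_simps diff_divide_distrib)
      qed
      show "AE w in M. norm (?s i w) \<le> W w" for i
      proof (rule AE_I2)
        fix w
        have "norm (exp (- S i * X w) - exp (- z * X w))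
                \<le> norm (exp (- (z - 2 * d) * X w)) / d * norm (S i - z)"
          using S d bound by (intro field_differentiable_bound[OF convex_ball[of z d] dexp]) auto
        then have "norm ((exp (- S i * X w) - exp (- z * X w)) / (S i - z))
                \<le> norm (exp (- (z - 2 * d) * X w)) / d"
          using S by (simp add: norm_divide field_simps)
        from mult_right_mono[OF this, of "norm (g w)"]
        show "norm (?s i w) \<le> W w"
          by (simp add: W_def norm_mult[symmetric] algebra_simps diff_divide_distrib)
            (simp add: W_def norm_mult norm_divide mult_ac)
      qed
    qed
    also have "(\<lambda>i. \<integral>w. ?s i w \<partial>M) = ((\<lambda>y. (?F y - ?F z) / (y - z)) \<circ> S)"
      using int[OF ReS] int[OF z] by (simp add: fun_eq_iff)
    finally show "((\<lambda>y. (?F y - ?F z) / (y - z)) \<circ> S)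
        \<longlonglongrightarrow> - (\<integral>w. X w * (exp (- z * X w) * g w) \<partial>M)"
      by (simp only: Bochner_Integration.integral_minus)
  qed
  then show "(?F has_field_derivative - (\<integral>w. X w * (exp (- z * X w) * g w) \<partial>M)) (at z)"
    using d by (simp add: has_field_derivative_iff at_within_open[of z "ball z d"])
qed

text \<open>
  With one variable frozen, the exponential in it belongs to the weight, and the one-variable lemma
  applies in the other. Each application raises one power by one and keeps the quarter-space of
  integrability, so integrability for all powers follows by induction from the unweighted case.
\<close>

lemma two_variable_laplace_moments:
  fixes X Y :: "'w \<Rightarrow> real" and K :: "'w \<Rightarrow> complex"
    and r s :: complex and E :: "nat \<Rightarrow> nat \<Rightarrow> complex \<Rightarrow> complex \<Rightarrow> 'w \<Rightarrow> complex"
  assumes X [measurable]: "X \<in> borel_measurable M" and Y [measurable]: "Y \<in> borel_measurable M"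
    and X0: "\<And>w. 0 \<le> X w" and Y0: "\<And>w. 0 \<le> Y w"
    and int: "\<And>(r :: complex) (s :: complex). a < Re r \<Longrightarrow> b < Re s \<Longrightarrow>
      integrable M (\<lambda>w. exp (- r * X w - s * Y w) * K w)"
  defines "E \<equiv> \<lambda>m n (r :: complex) (s :: complex) w. (X w ^ m * Y w ^ n) * (exp (- r * X w - s * Y w) * K w)"
  assumes r: "a < Re r" and s: "b < Re s"
  shows two_variable_laplace_integrable: "integrable M (E m n r s)"
    and two_variable_laplace_deriv_r:
      "((\<lambda>r. integral\<^sup>L M (E m n r s)) has_field_derivative - integral\<^sup>L M (E (Suc m) n r s)) (at r)"
    and two_variable_laplace_deriv_s:
      "((\<lambda>s. integral\<^sup>L M (E m n r s)) has_field_derivative - integral\<^sup>L M (E m (Suc n) r s)) (at s)"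
proof -
  have Er: "E m n r s = (\<lambda>w. exp (- r * X w) * (X w ^ m * Y w ^ n * exp (- s * Y w) * K w))"
    for m n and r s :: complex
    by (simp add: E_def fun_eq_iff exp_diff exp_minus field_simps)
  have Es: "E m n r s = (\<lambda>w. exp (- s * Y w) * (X w ^ m * Y w ^ n * exp (- r * X w) * K w))"
    for m n and r s :: complex
    by (simp add: E_def fun_eq_iff exp_diff exp_minus field_simps)
  have Er': "E (Suc m) n r s = (\<lambda>w. X w * (exp (- r * X w) * (X w ^ m * Y w ^ n * exp (- s * Y w) * K w)))"
    for m n and r s :: complex
    unfolding Er by (simp add: mult_ac)
  have Es': "E m (Suc n) r s = (\<lambda>w. Y w * (exp (- s * Y w) * (X w ^ m * Y w ^ n * exp (- r * X w) * K w)))"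
    for m n and r s :: complex
    unfolding Es by (simp add: mult_ac)
  have E0: "integrable M (E m 0 r s)" if "a < Re r" "b < Re s" for m and r s :: complex
    using that(1)
  proof (induction m arbitrary: r)
    case 0
    then show ?case using int[OF _ that(2)] by (simp add: E_def)
  next
    case (Suc m)
    show ?case unfolding Er'
      by (rule integrable_laplace_moment[OF X X0 _ Suc.prems]) (use Suc.IH in \<open>simp add: Er\<close>)
  qed
  have E: "integrable M (E m n r s)" if "a < Re r" "b < Re s" for m n and r s :: complex
    using that(2)
  proof (induction n arbitrary: s)
    case 0
    then show ?case using E0 that(1) by blast
  next
    case (Suc n)
    show ?case unfolding Es'
      by (rule integrable_laplace_moment[OF Y Y0 _ Suc.prems]) (use Suc.IH in \<open>simp add: Es\<close>)
  qed
  show "integrable M (E m n r s)" by (rule E[OF r s])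
  show "((\<lambda>r. integral\<^sup>L M (E m n r s)) has_field_derivative - integral\<^sup>L M (E (Suc m) n r s)) (at r)"
    unfolding Er' unfolding Er
    by (rule has_field_derivative_laplace[OF X X0 _ r]) (use E[OF _ s, of _ m n] in \<open>simp add: Er\<close>)
  show "((\<lambda>s. integral\<^sup>L M (E m n r s)) has_field_derivative - integral\<^sup>L M (E m (Suc n) r s)) (at s)"
    unfolding Es' unfolding Es
    by (rule has_field_derivative_laplace[OF Y Y0 _ s]) (use E[OF r, of _ m n] in \<open>simp add: Es\<close>)
qed

section \<open>Fubini for the Lebesgue measure of the plane\<close>

text \<open>
  The completed plane measure is not the product of the completed line measures, so the product
  form of Fubini is applied to a Borel function \<open>g\<close> that agrees with \<open>f\<close> almost everywhere.
  Almost every section of \<open>f\<close> then agrees almost everywhere with the section of \<open>g\<close>, and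
  completeness of the line measure makes it measurable with the same integral.
\<close>

lemma Fubini_lebesgue_complex:
  fixes f :: "real \<times> real \<Rightarrow> complex"
  assumes f: "integrable lebesgue f"
  shows "(LINT t|lebesgue. LINT x|lebesgue. f (x, t)) = integral\<^sup>L lebesgue f"
proof -
  have [measurable]: "f \<in> borel_measurable (completion lborel)" using f by auto
  obtain g1 g2 where [measurable]: "g1 \<in> borel_measurable lborel" "g2 \<in> borel_measurable lborel"
    and ae: "AE w in lborel. Re (f w) = g1 w" "AE w in lborel. Im (f w) = g2 w"
    using completion_ex_borel_measurable_real[of "\<lambda>w. Re (f w)" lborel]
      completion_ex_borel_measurable_real[of "\<lambda>w. Im (f w)" lborel] by auto
  define g where "g w = Complex (g1 w) (g2 w)" for w
  have g [measurable]: "g \<in> borel_measurable borel"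
    unfolding g_def Complex_eq by measurable
  have fg: "AE w in lborel. g w = f w"
    using ae by eventually_elim (simp add: g_def complex_eq_iff)
  have fg': "AE w in lebesgue. g w = f w" by (rule AE_completion[OF fg])
  have g_int: "integrable (lborel \<Otimes>\<^sub>M lborel) g"
    using f integrable_cong_AE[OF _ _ fg'] integrable_completion[of g lborel]
    by (auto simp: lborel_prod measurable_completion)
  \<comment> \<open>The inner integral runs over the first coordinate, whereas \<open>AE_pair\<close> takes sections in the
     second; hence the swap of coordinates.\<close>
  have "AE w in (lborel \<Otimes>\<^sub>M lborel). g (snd w, fst w) = f (snd w, fst w)"
  proof -
    have "AE w in distr (lborel \<Otimes>\<^sub>M lborel) (lborel \<Otimes>\<^sub>M lborel) (\<lambda>(x, y). (y, x)). g w = f w"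
    proof -
      have "AE w in lborel \<Otimes>\<^sub>M lborel. g w = f w" unfolding lborel_prod by (rule fg)
      then show ?thesis by (subst lborel_pair.distr_pair_swap[symmetric])
    qed
    from AE_distrD[OF measurable_pair_swap' this] show ?thesis
      by (simp add: case_prod_beta)
  qed
  then have sec: "AE t in lborel. AE x in lborel. g (x, t) = f (x, t)"
    using lborel_pair.AE_pair by fastforce
  have inner: "AE t in lborel. (LINT x|lebesgue. f (x, t)) = (LINT x|lborel. g (x, t))"
    using sec
  proof eventually_elim
    case (elim t)
    have gt: "(\<lambda>x. g (x, t)) \<in> borel_measurable lborel" by measurable
    have "AE x in lebesgue. g (x, t) = f (x, t)" using elim by (rule AE_completion)
    moreover from this have "(\<lambda>x. f (x, t)) \<in> borel_measurable lebesgue"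
      by (rule borel_measurable_AE[OF measurable_completion[OF gt]])
    ultimately have "(LINT x|lebesgue. f (x, t)) = (LINT x|lebesgue. g (x, t))"
      using gt by (intro integral_cong_AE) (auto simp: measurable_completion)
    then show ?case using gt by (simp add: integral_completion)
  qed
  have inner_meas: "(\<lambda>t. LINT x|lborel. g (x, t)) \<in> borel_measurable lborel" by measurable
  have "(LINT t|lebesgue. LINT x|lebesgue. f (x, t)) = (LINT t|lebesgue. LINT x|lborel. g (x, t))"
  proof (rule integral_cong_AE)
    show ae': "AE t in lebesgue. (LINT x|lebesgue. f (x, t)) = (LINT x|lborel. g (x, t))"
      by (rule AE_completion[OF inner])
    show 1: "(\<lambda>t. LINT x|lborel. g (x, t)) \<in> borel_measurable lebesgue"
      by (rule measurable_completion[OF inner_meas])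
    show "(\<lambda>t. LINT x|lebesgue. f (x, t)) \<in> borel_measurable lebesgue"
      by (rule borel_measurable_AE[OF 1]) (use ae' in \<open>auto simp: eq_commute\<close>)
  qed
  also have "\<dots> = (LINT t|lborel. LINT x|lborel. g (x, t))"
    by (rule integral_completion[OF inner_meas])
  also have "\<dots> = integral\<^sup>L lborel g"
    using lborel_pair.integral_snd[of "\<lambda>x t. g (x, t)"] g_int by (simp add: lborel_prod)
  also have "\<dots> = integral\<^sup>L lebesgue g" by (simp add: integral_completion)
  also have "\<dots> = integral\<^sup>L lebesgue f"
    by (rule integral_cong_AE) (auto simp: measurable_completion fg')
  finally show ?thesis .
qed

section \<open>Measurability and integrability of the transformed function\<close>

text \<open>
  Continuity at a point of an open set is a local matter, so pieces belonging to different
  rectangles may be merged without compatibility conditions; what remains of the quadrant is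
  covered by countably many boundaries.
\<close>

lemma piecewise_continuous_quadrant_open_conull:
  assumes "piecewise_continuous_quadrant h"
  obtains W where "open W" "continuous_on W (\<lambda>(u, v). h u v)" "negligible ({0..} \<times> {0..} - W)"
proof -
  have "\<exists>\<U>. finite \<U> \<and> (\<Union>U\<in>\<U>. closure U) = {0..real (Suc n)} \<times> {0..real (Suc n)} \<and>
       (\<forall>U\<in>\<U>. open U \<and> negligible (frontier U) \<and> continuous_on U (\<lambda>(u, v). h u v))" for n
  proof -
    have "0 < real (Suc n)" by simp
    from assms[unfolded piecewise_continuous_quadrant_def, rule_format, OF this this]
    show ?thesis by (rule ex_forward) blast
  qed
  then obtain \<U> where fin: "\<And>n. finite (\<U> n)"
    and cover: "\<And>n. (\<Union>U\<in>\<U> n. closure U) = {0..real (Suc n)} \<times> {0..real (Suc n)}"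
    and U: "\<And>n U. U \<in> \<U> n \<Longrightarrow> open U \<and> negligible (frontier U) \<and> continuous_on U (\<lambda>(u, v). h u v)"
    by metis
  define W where "W = \<Union>(\<Union>n. \<U> n)"
  show thesis
  proof
    show "open W" using U by (auto simp: W_def)
    show "continuous_on W (\<lambda>(u, v). h u v)"
      unfolding W_def by (rule continuous_on_open_Union) (use U in auto)
    have "negligible (\<Union>n. \<Union>(frontier ` \<U> n))"
      by (rule negligible_countable_Union) (use fin U in \<open>auto intro!: negligible_Union\<close>)
    moreover have "{0..} \<times> {0..} - W \<subseteq> (\<Union>n. \<Union>(frontier ` \<U> n))"
    proof
      fix z assume z: "z \<in> {0..} \<times> {0..} - W"
      obtain u v where uv: "z = (u, v)" by fastforce
      obtain n where n: "max u v \<le> real n" using real_arch_simple by blast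
      have "z \<in> {0..real (Suc n)} \<times> {0..real (Suc n)}" using z uv n by auto
      then obtain V where V: "V \<in> \<U> n" "z \<in> closure V" using cover[of n] by blast
      then have "z \<in> frontier V"
        using z U[OF V(1)] by (auto simp: frontier_def W_def interior_open)
      with V show "z \<in> (\<Union>n. \<Union>(frontier ` \<U> n))" by blast
    qed
    ultimately show "negligible ({0..} \<times> {0..} - W)" by (rule negligible_subset)
  qed
qed

text \<open>
  Composition with a continuous map can destroy Lebesgue measurability. Here the substitution
  \<open>\<phi>\<close> has the differentiable inverse \<open>\<psi>\<close> on the open quadrant, and differentiable maps send
  negligible sets to negligible sets, so the preimage of the exceptional set is still negligible and
  the composition is continuous on an open set of full measure.
\<close>

lemma measurable_conformable_substitution:
  fixes p q :: real
  assumes p: "0 < p" and q: "0 < q" and h: "piecewise_continuous_quadrant h"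
  shows "(\<lambda>(x, t). indicator ({0<..} \<times> {0<..}) (x, t) * h (x powr p / p) (t powr q / q))
           \<in> borel_measurable lebesgue"
proof -
  obtain W where W: "open W" "continuous_on W (\<lambda>(u, v). h u v)" "negligible ({0..} \<times> {0..} - W)"
    using piecewise_continuous_quadrant_open_conull[OF h] .
  let ?Q = "{0<..} \<times> {0<..} :: (real \<times> real) set"
  define \<phi> where "\<phi> = (\<lambda>(x, t). (x powr p / p, t powr q / q))"
  define \<psi> where "\<psi> = (\<lambda>(u, v). ((p * u) powr (1 / p), (q * v) powr (1 / q)))"
  define V where "V = ?Q \<inter> \<phi> -` W"
  have Q: "open ?Q" by (intro open_Times open_greaterThan)
  have cont: "continuous_on ?Q \<phi>"
    unfolding \<phi>_def case_prod_beta using p q by (auto intro!: continuous_intros)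
  have V: "open V"
    unfolding V_def by (rule continuous_open_preimage[OF cont Q W(1)])
  have contV: "continuous_on V (\<lambda>(x, t). h (x powr p / p) (t powr q / q))"
  proof -
    have "continuous_on V ((\<lambda>(u, v). h u v) \<circ> \<phi>)"
      by (rule continuous_on_compose)
        (auto simp: V_def intro: continuous_on_subset[OF cont] continuous_on_subset[OF W(2)])
    then show ?thesis by (simp add: o_def \<phi>_def case_prod_beta)
  qed
  have neg: "negligible (?Q - V)"
  proof (rule negligible_subset)
    have "\<psi> differentiable_on ?Q"
    proof -
      have powr: "(\<lambda>x. (c * x) powr (1 / c)) differentiable (at x)" if "0 < c" "0 < x" for c x :: real
        using that unfolding real_differentiable_def
        by (intro exI) (rule derivative_eq_intros refl | simp)+
      have "\<psi> differentiable (at z)" if "z \<in> ?Q" for z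
      proof -
        have "((\<lambda>x. (p * x) powr (1 / p)) \<circ> fst) differentiable (at z)"
          "((\<lambda>x. (q * x) powr (1 / q)) \<circ> snd) differentiable (at z)"
          using that p q
          by (auto intro!: differentiable_chain_at powr bounded_linear_imp_differentiable[OF bounded_linear_fst]
              bounded_linear_imp_differentiable[OF bounded_linear_snd] simp del: o_apply)
        then obtain D1 D2 where "((\<lambda>z. (p * fst z) powr (1 / p)) has_derivative D1) (at z)"
          "((\<lambda>z. (q * snd z) powr (1 / q)) has_derivative D2) (at z)"
          unfolding differentiable_def o_def by blast
        from has_derivative_Pair[OF this] show ?thesis
          unfolding differentiable_def \<psi>_def case_prod_beta by blast
      qed
      then show ?thesis by (simp add: differentiable_at_imp_differentiable_on)
    qed
    then show "negligible (\<psi> ` (?Q - W))"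
      by (intro negligible_differentiable_image_negligible negligible_subset[OF W(3)])
        (auto intro: differentiable_on_subset)
    show "?Q - V \<subseteq> \<psi> ` (?Q - W)"
    proof
      fix z assume z: "z \<in> ?Q - V"
      then have "\<phi> z \<in> ?Q - W" using p q by (auto simp: V_def \<phi>_def)
      moreover have "\<psi> (\<phi> z) = z"
        using z p q by (auto simp: \<phi>_def \<psi>_def powr_powr)
      ultimately show "z \<in> \<psi> ` (?Q - W)" by (metis imageI)
    qed
  qed
  have "(\<lambda>z. indicat_real V z *\<^sub>R (case z of (x, t) \<Rightarrow> h (x powr p / p) (t powr q / q)))
          \<in> borel_measurable borel"
    using V contV by (intro borel_measurable_continuous_on_indicator) auto
  then have "(\<lambda>z. indicat_real V z *\<^sub>R (case z of (x, t) \<Rightarrow> h (x powr p / p) (t powr q / q)))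
          \<in> borel_measurable lebesgue" by (simp add: measurable_completion)
  moreover have "AE z in lebesgue. z \<notin> ?Q - V"
    using neg by (intro AE_not_in) (simp add: negligible_iff_null_sets)
  then have "AE z in lebesgue. indicat_real V z *\<^sub>R (case z of (x, t) \<Rightarrow> h (x powr p / p) (t powr q / q))
     = (case z of (x, t) \<Rightarrow> indicator ?Q (x, t) * h (x powr p / p) (t powr q / q))"
    by eventually_elim (auto simp: indicator_def V_def)
  ultimately show ?thesis by (rule borel_measurable_AE)
qed

text \<open>
  The factor \<open>x powr (p - 1)\<close> is the derivative of \<open>x powr p / p\<close>, so the function has the bounded
  antiderivative \<open>- exp (- c * (x powr p / p)) / c\<close>. The interval is open at \<open>0\<close> because the
  function need not be continuous there.
\<close>

lemma conformable_exponential_integrable: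
  fixes p c :: real
  assumes p: "0 < p" and c: "0 < c"
  shows "integrable lborel (\<lambda>x. indicator {0<..} x * (exp (- c * (x powr p / p)) * x powr (p - 1)))"
proof -
  let ?f = "\<lambda>x. exp (- c * (x powr p / p)) * x powr (p - 1)"
  let ?F = "\<lambda>x. - exp (- c * (x powr p / p)) / c"
  have "set_integrable lborel (einterval 0 \<infinity>) ?f"
  proof (rule interval_integral_FTC_nonneg)
    show "DERIV ?F x :> ?f x" if "0 < ereal x" "ereal x < \<infinity>" for x
    proof -
      have "DERIV (\<lambda>x. x powr p) x :> p * x powr (p - 1)"
        using that by (intro has_real_derivative_powr) auto
      from DERIV_cmult[OF DERIV_fun_exp[OF DERIV_cmult[OF this, of "- c / p"]], of "- 1 / c"]
      show ?thesis using p c by simp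
    qed
    show "isCont ?f x" if "0 < ereal x" "ereal x < \<infinity>" for x
      using that p by (auto intro!: continuous_intros)
    have "((\<lambda>x. - exp (- c * (x powr p / p)) / c) \<longlongrightarrow> - exp (- c * (0 powr p / p)) / c) (at_right 0)"
      using p c by (auto intro!: tendsto_eq_intros tendsto_powr' simp: eventually_at_filter)
    then show "((?F \<circ> real_of_ereal) \<longlongrightarrow> - exp (- c * (0 powr p / p)) / c) (at_right 0)"
      by (simp add: ereal_tendsto_simps zero_ereal_def)
    have "filterlim (\<lambda>x. x powr p) at_top at_top"
    proof -
      have "((\<lambda>x. x powr - p) \<longlongrightarrow> 0) at_top"
        by (rule tendsto_neg_powr) (use p in \<open>auto simp: filterlim_ident\<close>)
      moreover have "eventually (\<lambda>x. 0 < x powr - p) at_top"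
        using eventually_gt_at_top[of 0] by eventually_elim simp
      ultimately have "filterlim (\<lambda>x. inverse (x powr - p)) at_top at_top"
        by (rule filterlim_inverse_at_top)
      then show ?thesis by (simp add: powr_minus)
    qed
    then have "filterlim (\<lambda>x. (c / p) * x powr p) at_top at_top"
      using p c by (intro filterlim_tendsto_pos_mult_at_top[OF tendsto_const]) auto
    then have "filterlim (\<lambda>x. - (c * (x powr p / p))) at_bot at_top"
      by (simp add: filterlim_uminus_at_bot)
    then have "((\<lambda>x. exp (- (c * (x powr p / p)))) \<longlongrightarrow> 0) at_top"
      by (rule filterlim_compose[OF exp_at_bot])
    from tendsto_divide[OF tendsto_minus[OF this] tendsto_const, of c]
    show "((?F \<circ> real_of_ereal) \<longlongrightarrow> 0) (at_left \<infinity>)"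
      using c by (simp add: ereal_tendsto_simps)
  qed auto
  moreover have "einterval 0 \<infinity> = {0<..}" by (auto simp: einterval_def zero_ereal_def)
  ultimately show ?thesis by (simp add: set_integrable_def)
qed

lemma integrable_lborel_product:
  fixes f g :: "real \<Rightarrow> real"
  assumes f: "integrable lborel f" and g: "integrable lborel g"
  shows "integrable lborel (\<lambda>(x, t). f x * g t)"
proof -
  have [measurable]: "f \<in> borel_measurable borel" "g \<in> borel_measurable borel" using f g by auto
  have "integrable (lborel \<Otimes>\<^sub>M lborel) (\<lambda>(x, t). f x * g t)"
    by (rule lborel_pair.Fubini_integrable) (use f g in \<open>auto simp: norm_mult abs_mult\<close>)
  then show ?thesis by (simp add: lborel_prod)
qed

text \<open>
  Exponential order bounds the kernel by a product of two one-dimensional functions, with decay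
  rates \<open>Re r - a\<close> and \<open>Re s - b\<close>.
\<close>

lemma conformable_kernel_integrable:
  fixes p q a b :: real and h :: "real \<Rightarrow> real \<Rightarrow> real" and r s :: complex
  assumes p: "0 < p" and q: "0 < q"
    and h: "piecewise_continuous_quadrant h" and ord: "exponential_order h a b"
    and r: "a < Re r" and s: "b < Re s"
  shows "integrable lebesgue (\<lambda>w. exp (- r * of_real (fst w powr p / p) - s * of_real (snd w powr q / q)) *
    complex_of_real (indicator ({0<..} \<times> {0<..}) w * h (fst w powr p / p) (snd w powr q / q) *
      fst w powr (p - 1) * snd w powr (q - 1)))"
    (is "integrable lebesgue ?f")
proof -
  obtain C where C: "\<And>u v. 0 < u \<Longrightarrow> 0 < v \<Longrightarrow> \<bar>h u v\<bar> / exp (a * u + b * v) \<le> C"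
    using ord unfolding exponential_order_def bdd_above_def by fastforce
  have hC: "\<bar>h u v\<bar> \<le> C * (exp (a * u) * exp (b * v))" if "0 < u" "0 < v" for u v
    using C[OF that] by (simp add: exp_add field_simps)
  define B where "B c p x = indicator {0<..} x * (exp (- c * (x powr p / p)) * x powr (p - 1))"
    for c p x :: real
  have "integrable lborel (\<lambda>(x, t). B (Re r - a) p x * B (Re s - b) q t)"
    unfolding B_def using p q r s
    by (intro integrable_lborel_product conformable_exponential_integrable) auto
  then have "integrable lebesgue (\<lambda>(x, t). B (Re r - a) p x * B (Re s - b) q t)"
    using integrable_completion[OF borel_measurable_integrable] by blast
  then have dom: "integrable lebesgue (\<lambda>w. C * (B (Re r - a) p (fst w) * B (Re s - b) q (snd w)))"
    by (intro integrable_mult_right) (simp add: case_prod_unfold)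
  have [measurable]: "(\<lambda>w. indicat_real ({0<..} \<times> {0<..}) w * h (fst w powr p / p) (snd w powr q / q))
      \<in> borel_measurable lebesgue"
    using measurable_conformable_substitution[OF p q h] by (simp add: case_prod_unfold)
  have [measurable]: "fst \<in> borel_measurable (lebesgue :: (real \<times> real) measure)"
    "snd \<in> borel_measurable (lebesgue :: (real \<times> real) measure)"
    by (auto intro!: measurable_completion borel_measurable_continuous_onI continuous_intros)
  show ?thesis
  proof (rule Bochner_Integration.integrable_bound[OF dom])
    show "?f \<in> borel_measurable lebesgue" by measurable
    have "norm (?f (x, t)) \<le> norm (C * (B (Re r - a) p x * B (Re s - b) q t))" for x t :: real
    proof (cases "0 < x \<and> 0 < t")
      case True
      let ?u = "x powr p / p" and ?v = "t powr q / q"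
      have "norm (?f (x, t)) = exp (- Re r * ?u - Re s * ?v) * \<bar>h ?u ?v\<bar> * (x powr (p - 1) * t powr (q - 1))"
        using True by (simp add: norm_mult abs_mult)
      also have "\<dots> \<le> exp (- Re r * ?u - Re s * ?v) * (C * (exp (a * ?u) * exp (b * ?v)))
          * (x powr (p - 1) * t powr (q - 1))"
        using True p q by (intro mult_right_mono mult_left_mono hC) auto
      also have "\<dots> = C * (exp (- (Re r - a) * ?u) * exp (- (Re s - b) * ?v))
          * (x powr (p - 1) * t powr (q - 1))"
      proof -
        have "exp (- Re r * u - Re s * v) * (C * (exp (a * u) * exp (b * v)))
            = C * (exp (- (Re r - a) * u) * exp (- (Re s - b) * v))" for u v
          by (simp add: exp_add[symmetric] algebra_simps)
        then show ?thesis by presburger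
      qed
      also have "\<dots> = C * (B (Re r - a) p x * B (Re s - b) q t)"
        using True by (simp add: B_def mult_ac)
      finally show ?thesis by simp
    qed (auto simp: B_def)
    then show "AE w in lebesgue. norm (?f w) \<le> norm (C * (B (Re r - a) p (fst w) * B (Re s - b) q (snd w)))"
      by (intro AE_I2) (metis prod.collapse)
  qed
qed

section \<open>The transforms of the moments as derivatives of one function\<close>

lemma cdarat_eq_lebesgue_integral:
  assumes "cdarat_converges p q f r s"
  shows "cdarat p q f r s = r * s *
    (LINT w|lebesgue. indicator ({0..} \<times> {0..}) w *\<^sub>R (case w of (x, t) \<Rightarrow> cdarat_integrand p q f r s x t))"
proof -
  let ?k = "\<lambda>w. indicator ({0..} \<times> {0..}) w *\<^sub>R (case w of (x, t) \<Rightarrow> cdarat_integrand p q f r s x t)"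
  have "(LINT x|lebesgue. ?k (x, t)) = indicator {0..} t *\<^sub>R (LINT x:{0..}|lebesgue. cdarat_integrand p q f r s x t)"
    for t
  proof -
    have "?k (x, t) = indicator {0..} t *\<^sub>R (indicator {0..} x *\<^sub>R cdarat_integrand p q f r s x t)" for x
      by (simp add: indicator_times mult.commute)
    then show ?thesis
      by (simp only: set_lebesgue_integral_def Bochner_Integration.integral_scaleR_right)
  qed
  then show ?thesis
    using Fubini_lebesgue_complex[OF assms[unfolded cdarat_converges_def set_integrable_def]]
    by (simp only: cdarat_def set_lebesgue_integral_def)
qed

text \<open>
  All six functions to be transformed are instances of the following family, which is closed under
  the two operations that differentiation in \<open>r\<close> and \<open>s\<close> performs.
\<close>

definition conformable_moment ::
  "real \<Rightarrow> real \<Rightarrow> (real \<Rightarrow> real \<Rightarrow> real) \<Rightarrow> nat \<Rightarrow> nat \<Rightarrow> real \<Rightarrow> real \<Rightarrow> real" where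
  "conformable_moment p q h m n x t =
    (x powr p / p) ^ m * (t powr q / q) ^ n * h (x powr p / p) (t powr q / q)"

definition double_laplace_moment ::
  "real \<Rightarrow> real \<Rightarrow> (real \<Rightarrow> real \<Rightarrow> real) \<Rightarrow> nat \<Rightarrow> nat \<Rightarrow> complex \<Rightarrow> complex \<Rightarrow> complex" where
  "double_laplace_moment p q h m n r s =
    (LINT w|lebesgue. indicator ({0..} \<times> {0..}) w *\<^sub>R
      (case w of (x, t) \<Rightarrow> cdarat_integrand p q (conformable_moment p q h m n) r s x t))"

text \<open>
  The general results on Laplace integrals are applied to the Lebesgue measure of the plane with
  exponents \<open>X = x powr p / p\<close> and \<open>Y = t powr q / q\<close>, the density \<open>x powr (p - 1) * t powr (q - 1)\<close>
  being part of the weight \<open>K\<close>.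
\<close>

lemma cdarat_moments:
  fixes p q a b :: real and h :: "real \<Rightarrow> real \<Rightarrow> real" and r s :: complex
  assumes p: "0 < p" and q: "0 < q"
    and h: "piecewise_continuous_quadrant h" and ord: "exponential_order h a b"
    and rs: "a < Re r" "b < Re s"
  shows cdarat_converges_moment: "cdarat_converges p q (conformable_moment p q h m n) r s"
    and cdarat_moment:
      "cdarat p q (conformable_moment p q h m n) r s = r * s * double_laplace_moment p q h m n r s"
    and double_laplace_moment_deriv_r:
      "((\<lambda>z. double_laplace_moment p q h m n z s) has_field_derivative
         - double_laplace_moment p q h (Suc m) n r s) (at r)"
    and double_laplace_moment_deriv_s:
      "((\<lambda>z. double_laplace_moment p q h m n r z) has_field_derivative
         - double_laplace_moment p q h m (Suc n) r s) (at s)"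
proof -
  define X where "X w = fst w powr p / p" for w :: "real \<times> real"
  define Y where "Y w = snd w powr q / q" for w :: "real \<times> real"
  define K where "K w = complex_of_real (indicator ({0<..} \<times> {0<..}) w * h (X w) (Y w) *
      fst w powr (p - 1) * snd w powr (q - 1))" for w
  define E where "E m n r s w = (X w ^ m * Y w ^ n) * (exp (- r * X w - s * Y w) * K w)"
    for m n and r s :: complex and w
  have [measurable]: "fst \<in> borel_measurable (lebesgue :: (real \<times> real) measure)"
    "snd \<in> borel_measurable (lebesgue :: (real \<times> real) measure)"
    by (auto intro!: measurable_completion borel_measurable_continuous_onI continuous_intros)
  have X: "X \<in> borel_measurable lebesgue" "\<And>w. 0 \<le> X w"
    and Y: "Y \<in> borel_measurable lebesgue" "\<And>w. 0 \<le> Y w"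
    using p q unfolding X_def Y_def by auto
  have int: "integrable lebesgue (\<lambda>w. exp (- r * X w - s * Y w) * K w)"
    if "a < Re r" "b < Re s" for r s :: complex
    using conformable_kernel_integrable[OF p q h ord that] unfolding X_def Y_def K_def .
  note L = two_variable_laplace_moments[OF X(1) Y(1) X(2) Y(2) int, folded E_def]
  \<comment> \<open>The closed and the open quadrant give the same integrand, since \<open>0 powr y = 0\<close> for every \<open>y\<close>.\<close>
  have E: "indicator ({0..} \<times> {0..}) w *\<^sub>R
      (case w of (x, t) \<Rightarrow> cdarat_integrand p q (conformable_moment p q h m n) r s x t) = E m n r s w"
    for m n r s w
    by (cases w)
      (auto simp: E_def K_def X_def Y_def cdarat_integrand_def conformable_moment_def indicator_def)
  show conv: "cdarat_converges p q (conformable_moment p q h m n) r s"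
    using L(1)[OF _ _ rs] unfolding cdarat_converges_def set_integrable_def E by blast
  show "cdarat p q (conformable_moment p q h m n) r s = r * s * double_laplace_moment p q h m n r s"
    unfolding cdarat_eq_lebesgue_integral[OF conv] double_laplace_moment_def ..
  show "((\<lambda>z. double_laplace_moment p q h m n z s) has_field_derivative
         - double_laplace_moment p q h (Suc m) n r s) (at r)"
    unfolding double_laplace_moment_def E by (rule L(2)[OF _ _ rs])
  show "((\<lambda>z. double_laplace_moment p q h m n r z) has_field_derivative
         - double_laplace_moment p q h m (Suc n) r s) (at s)"
    unfolding double_laplace_moment_def E by (rule L(3)[OF _ _ rs])
qed

section \<open>The five identities\<close>

text \<open>
  The calculus common to both variables: the transform is \<open>c * z * F0 z\<close>, where \<open>c\<close> is the other
  variable and differentiation carries \<open>F0\<close> to \<open>- F1\<close> and \<open>F1\<close> to \<open>- F2\<close>. The formulas have to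
  hold on an open set, because the second derivative is the derivative of the function \<open>deriv g\<close>.
\<close>

lemma derivatives_times_variable:
  fixes g F0 F1 F2 :: "complex \<Rightarrow> complex" and c :: complex
  assumes S: "open S" "z \<in> S" and g: "\<And>z. z \<in> S \<Longrightarrow> g z = c * z * F0 z"
    and F0: "\<And>z. z \<in> S \<Longrightarrow> (F0 has_field_derivative - F1 z) (at z)"
    and F1: "\<And>z. z \<in> S \<Longrightarrow> (F1 has_field_derivative - F2 z) (at z)"
  shows "(g has_field_derivative c * F0 z - c * z * F1 z) (at z)"
    and "(deriv g has_field_derivative c * z * F2 z - 2 * c * F1 z) (at z)"
    and "z \<noteq> 0 \<Longrightarrow> ((\<lambda>z. 1 / z * g z) has_field_derivative - c * F1 z) (at z)"
proof -
  have D: "(g has_field_derivative c * F0 z - c * z * F1 z) (at z)" if "z \<in> S" for z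
  proof (rule has_field_derivative_transform_within_open[OF _ S(1) that])
    show "((\<lambda>z. c * z * F0 z) has_field_derivative c * F0 z - c * z * F1 z) (at z)"
      using that by (auto intro!: derivative_eq_intros F0)
  qed (simp add: g)
  show "(g has_field_derivative c * F0 z - c * z * F1 z) (at z)" by (rule D[OF S(2)])
  show "(deriv g has_field_derivative c * z * F2 z - 2 * c * F1 z) (at z)"
  proof (rule has_field_derivative_transform_within_open[OF _ S])
    show "((\<lambda>z. c * F0 z - c * z * F1 z) has_field_derivative c * z * F2 z - 2 * c * F1 z) (at z)"
      using S(2) by (auto intro!: derivative_eq_intros F0 F1)
  qed (rule D[THEN DERIV_imp_deriv, symmetric])
  show "((\<lambda>z. 1 / z * g z) has_field_derivative - c * F1 z) (at z)" if "z \<noteq> 0"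
  proof (rule has_field_derivative_transform_within_open[where S = "S - {0}"])
    show "((\<lambda>z. c * F0 z) has_field_derivative - c * F1 z) (at z)"
      using S(2) by (auto intro!: derivative_eq_intros F0)
  qed (use S that g in auto)
qed

theorem theorem3:
  fixes p q a b :: real and h :: "real \<Rightarrow> real \<Rightarrow> real"
    and G :: "complex \<Rightarrow> complex \<Rightarrow> complex" and r s :: complex
  assumes "0 < p" "p \<le> 1" "0 < q" "q \<le> 1"
    and "piecewise_continuous_quadrant h"
    and "exponential_order h a b"
    and "G = cdarat p q (\<lambda>x t. h (x powr p / p) (t powr q / q))"
    and "r \<noteq> 0" "s \<noteq> 0" "Re r > a" "Re s > b"
  shows
    "cdarat_converges p q (\<lambda>x t. h (x powr p / p) (t powr q / q)) r s \<and>
     has_partial_r G r s \<and> has_partial_s G r s \<and>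
     (cdarat_converges p q (\<lambda>x t. (x powr p / p) * h (x powr p / p) (t powr q / q)) r s \<and>
      has_partial_r (\<lambda>r s. 1 / r * G r s) r s \<and>
      cdarat p q (\<lambda>x t. (x powr p / p) * h (x powr p / p) (t powr q / q)) r s
        = - r * partial_r (\<lambda>r s. 1 / r * G r s) r s) \<and>
     (cdarat_converges p q (\<lambda>x t. (t powr q / q) * h (x powr p / p) (t powr q / q)) r s \<and>
      has_partial_s (\<lambda>r s. 1 / s * G r s) r s \<and>
      cdarat p q (\<lambda>x t. (t powr q / q) * h (x powr p / p) (t powr q / q)) r s
        = - s * partial_s (\<lambda>r s. 1 / s * G r s) r s) \<and>
     (cdarat_converges p q (\<lambda>x t. (x powr p / p)^2 * h (x powr p / p) (t powr q / q)) r s \<and>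
      has_partial_r (partial_r G) r s \<and>
      cdarat p q (\<lambda>x t. (x powr p / p)^2 * h (x powr p / p) (t powr q / q)) r s
        = partial_r (partial_r G) r s - 2 / r * partial_r G r s + 2 / r^2 * G r s) \<and>
     (cdarat_converges p q (\<lambda>x t. (t powr q / q)^2 * h (x powr p / p) (t powr q / q)) r s \<and>
      has_partial_s (partial_s G) r s \<and>
      cdarat p q (\<lambda>x t. (t powr q / q)^2 * h (x powr p / p) (t powr q / q)) r s
        = partial_s (partial_s G) r s - 2 / s * partial_s G r s + 2 / s^2 * G r s) \<and>
     (cdarat_converges p q (\<lambda>x t. (x powr p / p) * (t powr q / q) * h (x powr p / p) (t powr q / q)) r s \<and>
      has_partial_r (partial_s G) r s \<and>
      cdarat p q (\<lambda>x t. (x powr p / p) * (t powr q / q) * h (x powr p / p) (t powr q / q)) r s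
        = partial_r (partial_s G) r s - 1 / s * partial_r G r s - 1 / r * partial_s G r s
            + 1 / (r * s) * G r s)"
proof -
  note G_def = assms(7) and nz = assms(8,9) and rs = assms(10,11)
  let ?F = "double_laplace_moment p q h"
  note hyps = assms(1,3,5,6)
  note Fr = double_laplace_moment_deriv_r[OF hyps] and Fs = double_laplace_moment_deriv_s[OF hyps]
  have f: "(\<lambda>x t. h (x powr p / p) (t powr q / q)) = conformable_moment p q h 0 0"
    "(\<lambda>x t. (x powr p / p) * h (x powr p / p) (t powr q / q)) = conformable_moment p q h 1 0"
    "(\<lambda>x t. (t powr q / q) * h (x powr p / p) (t powr q / q)) = conformable_moment p q h 0 1"
    "(\<lambda>x t. (x powr p / p)^2 * h (x powr p / p) (t powr q / q)) = conformable_moment p q h 2 0"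
    "(\<lambda>x t. (t powr q / q)^2 * h (x powr p / p) (t powr q / q)) = conformable_moment p q h 0 2"
    "(\<lambda>x t. (x powr p / p) * (t powr q / q) * h (x powr p / p) (t powr q / q))
       = conformable_moment p q h 1 1"
    by (simp_all add: fun_eq_iff conformable_moment_def)
  have G: "G z w = z * w * ?F 0 0 z w" if "a < Re z" "b < Re w" for z w
    unfolding G_def f by (rule cdarat_moment[OF hyps that])
  have openr: "open {z. a < Re z}" and opens: "open {z. b < Re z}"
    by (auto simp: open_halfspace_Re_gt)
  have Dr: "((\<lambda>z. G z w) has_field_derivative w * ?F 0 0 z w - w * z * ?F 1 0 z w) (at z)"
      "(deriv (\<lambda>z. G z w) has_field_derivative w * z * ?F 2 0 z w - 2 * w * ?F 1 0 z w) (at z)"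
      "z \<noteq> 0 \<Longrightarrow> ((\<lambda>z. 1 / z * G z w) has_field_derivative - w * ?F 1 0 z w) (at z)"
    if "a < Re z" "b < Re w" for z w
    by (rule derivatives_times_variable[OF openr, where z=z and c=w and g="\<lambda>z. G z w"
          and ?F0.0="\<lambda>z. ?F 0 0 z w" and ?F1.0="\<lambda>z. ?F 1 0 z w"
          and ?F2.0="\<lambda>z. ?F 2 0 z w"];
      use that Fr[of _ w 0 0] Fr[of _ w 1 0] in \<open>simp add: G numeral_2_eq_2\<close>)+
  have Ds: "((\<lambda>w. G z w) has_field_derivative z * ?F 0 0 z w - z * w * ?F 0 1 z w) (at w)"
      "(deriv (\<lambda>w. G z w) has_field_derivative z * w * ?F 0 2 z w - 2 * z * ?F 0 1 z w) (at w)"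
      "w \<noteq> 0 \<Longrightarrow> ((\<lambda>w. 1 / w * G z w) has_field_derivative - z * ?F 0 1 z w) (at w)"
    if "a < Re z" "b < Re w" for z w
    by (rule derivatives_times_variable[OF opens, where z=w and c=z and g="\<lambda>w. G z w"
          and ?F0.0="\<lambda>w. ?F 0 0 z w" and ?F1.0="\<lambda>w. ?F 0 1 z w"
          and ?F2.0="\<lambda>w. ?F 0 2 z w"];
      use that Fs[of z _ 0 0] Fs[of z _ 0 1] in \<open>simp add: G numeral_2_eq_2\<close>)+
  \<comment> \<open>The mixed derivative differentiates the closed form of \<open>partial_s G z s\<close>, which is valid for all
     \<open>z\<close> in the half-plane.\<close>
  have Drs: "((\<lambda>z. partial_s G z s) has_field_derivative
      ?F 0 0 r s - r * ?F 1 0 r s - s * ?F 0 1 r s + r * s * ?F 1 1 r s) (at r)"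
  proof (rule has_field_derivative_transform_within_open[OF _ openr])
    show "((\<lambda>z. z * ?F 0 0 z s - z * s * ?F 0 1 z s) has_field_derivative
        ?F 0 0 r s - r * ?F 1 0 r s - s * ?F 0 1 r s + r * s * ?F 1 1 r s) (at r)"
      using Fr[OF rs, of 0 0] Fr[OF rs, of 0 1]
      by (auto intro!: derivative_eq_intros simp: algebra_simps)
  qed (use rs in \<open>auto simp: partial_s_def simp del: One_nat_def
        intro!: Ds(1)[THEN DERIV_imp_deriv, symmetric]\<close>)
  note ders = Dr(1,2)[OF rs] Dr(3)[OF rs nz(1)] Ds(1,2)[OF rs] Ds(3)[OF rs nz(2)] Drs
  have partials: "partial_r G r s = s * ?F 0 0 r s - s * r * ?F 1 0 r s"
      "partial_r (partial_r G) r s = s * r * ?F 2 0 r s - 2 * s * ?F 1 0 r s"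
      "partial_r (\<lambda>r s. 1 / r * G r s) r s = - s * ?F 1 0 r s"
      "partial_s G r s = r * ?F 0 0 r s - r * s * ?F 0 1 r s"
      "partial_s (partial_s G) r s = r * s * ?F 0 2 r s - 2 * r * ?F 0 1 r s"
      "partial_s (\<lambda>r s. 1 / s * G r s) r s = - r * ?F 0 1 r s"
      "partial_r (partial_s G) r s = ?F 0 0 r s - r * ?F 1 0 r s - s * ?F 0 1 r s + r * s * ?F 1 1 r s"
    using ders[THEN DERIV_imp_deriv] unfolding partial_r_def partial_s_def by auto
  have exist: "has_partial_r G r s" "has_partial_s G r s" "has_partial_r (\<lambda>r s. 1 / r * G r s) r s"
      "has_partial_s (\<lambda>r s. 1 / s * G r s) r s" "has_partial_r (partial_r G) r s"
      "has_partial_s (partial_s G) r s" "has_partial_r (partial_s G) r s"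
    using ders unfolding has_partial_r_def has_partial_s_def partial_r_def partial_s_def
      field_differentiable_def by blast+
  show ?thesis
    unfolding f partials
    using cdarat_converges_moment[OF hyps rs] cdarat_moment[OF hyps rs] exist G[OF rs] nz
    by (simp add: field_simps power2_eq_square)
qed

end
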